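(* Let $n > 2$, let $k \mid n$ be such that every prime factor of $n$ is also a prime factor of $k$ (i.e., $k\text{-}G(Z_n)$ is connected), and let $H = Z_n$. Let $i$ be the largest positive integer such that $k^i \mid n$, and hence $n = qk^i$ for some integer $1 \leq q < k$. Let $w$ be the least positive integer such that $n \mid k^w$. The following statements hold: (1) If $q = 1$, then $w = i$. If $q \neq 1$, then $w = i+1$. (2) If $q = 1$ and $k > 2$, then $\operatorname{diam}(k\text{-}G(H)) = 2i = 2w$. (3) If $q = 1$ and $k = 2$, then $\operatorname{diam}(k\text{-}G(H)) = 2(i-1) = 2(w-1)$. (4) If $q = 2$, then $\operatorname{diam}(k\text{-}G(H)) = 2w-1 = 2i+1$. (5) If $q > 2$, then $\operatorname{diam}(k\text{-}G(H)) = 2w = 2(i+1)$.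
   Context: $Z_n$ is the additive cyclic group of integers modulo $n$. For an integer $r>1$, the graph $r\text{-}G(Z_n)$ is the simple undirected graph with vertex set $Z_n$ in which two distinct vertices $a,b$ are adjacent if and only if $ra=b$ or $rb=a$ in $Z_n$. The diameter of a graph is the maximum of the distances $d(a,b)$ (length of a shortest path) over all pairs of vertices.
   Formalization: The second half of (1) and all of (5) additionally assume q | k, and 1 ≤ q < k is assumed rather than derived; as printed they fail, e.g. n = 24, k = 6 gives i = 1, q = 4, w = 3 ≠ i+1, and n = 96, k = 6 gives q = 16 > k. *)

theory Defs
  imports
    "HOL-Algebra.Elementary_Groups"
    "HOL-Computational_Algebra.Primes"
    "Graph_Theory.Pair_Digraph"
    "Graph_Theory.Shortest_Path"
begin

text \<open>
  As usual in Graph_Theory, a simple undirected graph is a loop-free digraph with a symmetric set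
  of arcs (locale \<open>pair_graph\<close> in the finite case), an edge being a pair of opposite arcs.
  HOL-Algebra writes groups multiplicatively: in \<open>integer_mod_group n\<close>, with elements
  \<open>0, ..., n - 1\<close>, the power \<open>a [^] r\<close> is the multiple \<open>r a\<close> modulo \<open>n\<close>.
\<close>

definition multiple_graph :: "nat \<Rightarrow> ('a, 'b) monoid_scheme \<Rightarrow> 'a pair_pre_digraph" where
  "multiple_graph r H =
     \<lparr> pverts = carrier H,
       parcs = {(a, b). a \<in> carrier H \<and> b \<in> carrier H \<and> a \<noteq> b \<and>
                        (a [^]\<^bsub>H\<^esub> r = b \<or> b [^]\<^bsub>H\<^esub> r = a)} \<rparr>"

lemma pair_graph_multiple_graph:
  assumes "finite (carrier H)"
  shows "pair_graph (multiple_graph r H)"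
proof
  show "finite (pverts (multiple_graph r H))"
    using assms by (simp add: multiple_graph_def)
  have "parcs (multiple_graph r H) \<subseteq> carrier H \<times> carrier H"
    by (auto simp: multiple_graph_def)
  then show "finite (parcs (multiple_graph r H))"
    using assms by (auto intro: finite_subset)
  show "symmetric (multiple_graph r H)"
    by (auto simp: symmetric_def multiple_graph_def intro!: symI)
qed (auto simp: multiple_graph_def)

text \<open>
  With unit weights, \<open>\<mu>\<close> is the usual distance (\<open>\<infinity>\<close> if there is no path).  On a finite nonempty
  graph the supremum is a maximum.
\<close>

definition graph_dist :: "('a, 'b) pre_digraph \<Rightarrow> 'a \<Rightarrow> 'a \<Rightarrow> ereal" where
  "graph_dist G u v = wf_digraph.\<mu> G (\<lambda>_. 1) u v"

definition graph_diam :: "('a, 'b) pre_digraph \<Rightarrow> ereal" where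
  "graph_diam G = (SUP u\<in>verts G. SUP v\<in>verts G. graph_dist G u v)"

end

theory Submission
  imports Defs
begin

text \<open>
  Multiplication by \<open>k\<close> on \<open>Z\<^sub>n\<close> fixes \<open>0\<close>, and since \<open>n\<close> divides \<open>k\<^sup>w\<close>, its \<open>w\<close>-th iterate is
  constantly \<open>0\<close>.  The graph is therefore a tree rooted at \<open>0\<close>, in which the parent of \<open>x \<noteq> 0\<close> is
  \<open>k x\<close>, and the height of \<open>x\<close> above the root is the least \<open>j\<close> with \<open>k\<^sup>j x = 0\<close>.

  Two facts about such trees give every distance that is needed.  Descending from two vertices to a
  common ancestor bounds their distance from above (\<open>dist_le_common_ancestor\<close>), and if the two
  descents arrive there from different vertices other than the root, then no walk is shorter
  (\<open>dist_eq_if_branches_meet\<close>).  All heights are at most \<open>w\<close>, so the diameter is at most \<open>2 w\<close>.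

  The vertices \<open>1\<close> and \<open>-1\<close> have height \<open>w\<close>.  Their last ancestors before the root are
  \<open>k\<^bsup>w-1\<^esup>\<close> and its negative, and if \<open>n\<close> does not divide \<open>2 k\<^bsup>w-1\<^esup>\<close>, then these differ and the
  diameter is \<open>2 w\<close> (\<open>diam_twice_exponent\<close>).  This covers \<open>n = k\<^sup>i\<close> with \<open>k > 2\<close>, where \<open>w = i\<close>, and
  \<open>n = q k\<^sup>i\<close> with \<open>q > 2\<close> dividing \<open>k\<close>, where \<open>w = i + 1\<close>.  Two cases remain.

  If \<open>n = 2\<^sup>i\<close> and \<open>k = 2\<close>, then the root has a single child \<open>2\<^bsup>i-1\<^esup>\<close>, which takes over the role of
  the root: all vertices other than \<open>0\<close> are within \<open>i - 1\<close> of it, and \<open>1\<close> and \<open>-1\<close> first meet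
  there (\<open>diam_doubling_mod_power_2\<close>).

  If \<open>n = 2 k\<^sup>i\<close> with \<open>k > 2\<close>, then \<open>k\<close> is even, and the vertices of full height \<open>i + 1\<close> are the
  odd ones.  All of them lie above the same child \<open>k\<^sup>i\<close> of the root, so an extreme pair
  consists of a vertex of height \<open>i + 1\<close> and one of height \<open>i\<close> on another branch, such as \<open>1\<close>
  and \<open>2\<close> (\<open>diam_double_power\<close>).
\<close>

section \<open>Distance and diameter of a digraph\<close>

context wf_digraph
begin

lemma awalk_cost_unit: "awalk_cost (\<lambda>_. 1) p = real (length p)"
  by (induction p) simp_all

lemma graph_dist_le_length:
  assumes "awalk u p v" and "length p \<le> m"
  shows "graph_dist G u v \<le> real m"
proof -
  have "graph_dist G u v \<le> real (length p)"
    using min_cost_le_walk_cost[OF assms(1), of "\<lambda>_. 1"]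
    by (simp add: graph_dist_def awalk_cost_unit)
  also have "\<dots> \<le> real m" using assms(2) by simp
  finally show ?thesis .
qed

text \<open>
  A potential that drops by at most one along every arc drops by at most \<open>length p\<close> along a walk
  \<open>p\<close>.  Exhibiting one is a way to bound distances from below without analysing walks.
\<close>

lemma potential_le_graph_dist:
  fixes \<psi> :: "'a \<Rightarrow> int"
  assumes arc: "\<And>e. e \<in> arcs G \<Longrightarrow> \<psi> (tail G e) - \<psi> (head G e) \<le> 1"
  shows "real_of_int (\<psi> u - \<psi> v) \<le> graph_dist G u v"
proof -
  have "\<psi> u - \<psi> v \<le> int (length p)" if "awalk u p v" for p
    using that
  proof (induction p arbitrary: u)
    case Nil
    then show ?case by (simp add: awalk_Nil_iff)
  next
    case (Cons e p)
    then have "e \<in> arcs G" "u = tail G e" "awalk (head G e) p v"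
      by (simp_all add: awalk_Cons_iff)
    with Cons.IH[of "head G e"] arc[of e] show ?case by simp
  qed
  then have "real_of_int (\<psi> u - \<psi> v) \<le> real (length p)" if "awalk u p v" for p
    using that by (metis of_int_le_iff of_int_of_nat_eq)
  then show ?thesis
    unfolding graph_dist_def \<mu>_def by (intro INF_greatest) (simp add: awalk_cost_unit)
qed

end

lemma graph_diam_eqI:
  assumes "\<And>u v. u \<in> verts G \<Longrightarrow> v \<in> verts G \<Longrightarrow> graph_dist G u v \<le> d"
    and "a \<in> verts G" and "b \<in> verts G" and "graph_dist G a b = d"
  shows "graph_diam G = d"
proof (rule antisym)
  show "graph_diam G \<le> d"
    unfolding graph_diam_def by (intro SUP_least assms(1))
  show "d \<le> graph_diam G"
    unfolding graph_diam_def assms(4)[symmetric] by (intro SUP_upper2[of a] SUP_upper assms)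
qed

section \<open>The tree of a map all of whose orbits end in one fixed point\<close>

locale rooted_map = pair_wf_digraph G for G :: "'a pair_pre_digraph" +
  fixes f :: "'a \<Rightarrow> 'a" and r :: 'a
  assumes map_in: "x \<in> pverts G \<Longrightarrow> f x \<in> pverts G"
    and root_fixed: "f r = r"
    and reaches_root: "x \<in> pverts G \<Longrightarrow> \<exists>j. (f ^^ j) x = r"
    and parcs_eq:
      "parcs G = {(x, y). x \<in> pverts G \<and> y \<in> pverts G \<and> x \<noteq> y \<and> (f x = y \<or> f y = x)}"
begin

abbreviation gdist :: "'a \<Rightarrow> 'a \<Rightarrow> ereal" where
  "gdist \<equiv> graph_dist (with_proj G)"

definition height :: "'a \<Rightarrow> nat" where
  "height x = (LEAST j. (f ^^ j) x = r)"

lemma iterate_in: "x \<in> pverts G \<Longrightarrow> (f ^^ j) x \<in> pverts G"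
  by (induction j) (simp_all add: map_in)

lemma iterate_height: "x \<in> pverts G \<Longrightarrow> (f ^^ height x) x = r"
  unfolding height_def by (rule LeastI_ex) (rule reaches_root)

lemma height_le: "(f ^^ j) x = r \<Longrightarrow> height x \<le> j"
  unfolding height_def by (rule Least_le)

lemma height_Suc:
  assumes "x \<in> pverts G" and "x \<noteq> r"
  shows "height x = Suc (height (f x))"
proof (rule antisym)
  have "(f ^^ Suc (height (f x))) x = r"
    unfolding funpow_Suc_right using iterate_height map_in assms(1) by simp
  then show "height x \<le> Suc (height (f x))" by (rule height_le)
  obtain h where h: "height x = Suc h"
    using iterate_height[OF assms(1)] assms(2) by (cases "height x") simp_all
  have "(f ^^ h) (f x) = r"
    using iterate_height[OF assms(1)] unfolding h funpow_Suc_right by simp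
  then show "Suc (height (f x)) \<le> height x" unfolding h by (simp only: Suc_le_mono height_le)
qed

lemma height_iterate:
  assumes "x \<in> pverts G" and "(f ^^ j) x \<noteq> r"
  shows "height x = j + height ((f ^^ j) x)"
  using assms(2)
proof (induction j)
  case (Suc j)
  have "(f ^^ Suc j) x = r" if "(f ^^ j) x = r" using that root_fixed by simp
  with Suc.prems have not_root: "(f ^^ j) x \<noteq> r" by blast
  have "height ((f ^^ j) x) = Suc (height ((f ^^ Suc j) x))"
    using height_Suc[OF iterate_in[OF assms(1)] not_root] by simp
  with Suc.IH[OF not_root] show ?case by (simp only: add_Suc add_Suc_right)
qed simp

lemma dist_le_common_ancestor:
  assumes "u \<in> pverts G" and "v \<in> pverts G" and "(f ^^ s) u = (f ^^ t) v" and "s + t \<le> m"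
  shows "gdist u v \<le> real m"
proof -
  have to_ancestor: "\<exists>p. awalk x p ((f ^^ j) x) \<and> length p \<le> j" if "x \<in> pverts G" for x j
    using that
  proof (induction j arbitrary: x)
    case 0
    then show ?case by (intro exI[of _ "[]"]) (simp add: awalk_Nil_iff)
  next
    case (Suc j)
    then obtain p where p: "awalk (f x) p ((f ^^ Suc j) x)" "length p \<le> j"
      unfolding funpow_Suc_right using map_in by fastforce
    show ?case
    proof (cases "f x = x")
      case True
      with p show ?thesis by (metis le_SucI)
    next
      case False
      with Suc.prems map_in p have "awalk x ((x, f x) # p) ((f ^^ Suc j) x)"
        by (auto simp: awalk_Cons_iff parcs_eq)
      with p(2) show ?thesis by (metis length_Cons Suc_le_mono)
    qed
  qed
  have from_ancestor: "\<exists>p. awalk ((f ^^ j) x) p x \<and> length p \<le> j" if "x \<in> pverts G" for x j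
    using that
  proof (induction j)
    case 0
    then show ?case by (intro exI[of _ "[]"]) (simp add: awalk_Nil_iff)
  next
    case (Suc j)
    define y where "y = (f ^^ j) x"
    from Suc obtain p where p: "awalk y p x" "length p \<le> j"
      by (auto simp: y_def)
    have y: "y \<in> pverts G" using Suc.prems iterate_in y_def by simp
    show ?case
    proof (cases "f y = y")
      case True
      with p show ?thesis by (auto simp flip: y_def intro: le_SucI)
    next
      case False
      with y map_in p have "awalk (f y) ((f y, y) # p) x"
        by (auto simp: awalk_Cons_iff parcs_eq)
      with p(2) show ?thesis by (intro exI[of _ "(f y, y) # p"]) (simp flip: y_def)
    qed
  qed
  obtain p where p: "awalk u p ((f ^^ s) u)" "length p \<le> s"
    using to_ancestor assms(1) by blast
  obtain p' where p': "awalk ((f ^^ s) u) p' v" "length p' \<le> t"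
    using from_ancestor assms(2,3) by metis
  show ?thesis
    using p p' assms(4) by (intro graph_dist_le_length[OF awalk_appendI[OF p(1) p'(1)]]) simp
qed

lemma diam_eqI:
  assumes upper: "\<And>u v. u \<in> pverts G \<Longrightarrow> v \<in> pverts G \<Longrightarrow> gdist u v \<le> d"
    and attained: "gdist a b = d" and "a \<in> pverts G" and "b \<in> pverts G"
  shows "graph_diam (with_proj G) = d"
  using assms(3,4) by (intro graph_diam_eqI[OF _ _ _ attained]) (simp_all add: upper)

text \<open>
  The lower bound rests on a potential.  Let \<open>c = f\<^sup>s a\<close>.  A vertex in the subtree above \<open>c\<close>,
  \<open>c\<close> included, gets its height, and any other vertex gets twice the height of \<open>f c\<close> minus its own
  height.  The two prescriptions agree at \<open>f c\<close>, and the edge between \<open>c\<close> and \<open>f c\<close> is the only one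
  that leaves the subtree, so the potential changes by at most one along every edge.  The vertex
  \<open>b\<close> is outside the subtree, because its ancestor at the height of \<open>c\<close> is \<open>f\<^sup>t b \<noteq> c\<close>.
\<close>

lemma dist_eq_if_branches_meet:
  assumes a: "a \<in> pverts G" and b: "b \<in> pverts G"
    and meet: "(f ^^ Suc s) a = (f ^^ Suc t) b"
    and differ: "(f ^^ s) a \<noteq> (f ^^ t) b"
    and not_root: "(f ^^ s) a \<noteq> r" "(f ^^ t) b \<noteq> r"
  shows "gdist a b = real (Suc s + Suc t)"
proof (rule antisym)
  show "gdist a b \<le> real (Suc s + Suc t)"
    using a b meet order_refl by (rule dist_le_common_ancestor)
  define c where "c = (f ^^ s) a"
  define m where "m = height (f c)"
  define above where "above x \<longleftrightarrow> (\<exists>j. (f ^^ j) x = c)" for x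
  define \<psi> where "\<psi> x = (if above x then int (height x) else 2 * int m - int (height x))" for x
  have c: "c \<in> pverts G" "c \<noteq> r" "height c = Suc m"
    using a iterate_in not_root height_Suc by (simp_all add: c_def m_def)
  have height_a: "height a = s + Suc m"
    using height_iterate[OF a not_root(1)] c(3) by (simp add: c_def)
  have "f ((f ^^ t) b) = f c" using meet by (simp add: c_def)
  then have height_b: "height b = t + Suc m"
    using height_iterate[OF b not_root(2)] height_Suc[OF iterate_in[OF b] not_root(2)]
    by (simp add: m_def)
  have "above a" by (auto simp: above_def c_def)
  have "\<not> above b"
  proof
    assume "above b"
    then obtain j where j: "(f ^^ j) b = c" by (auto simp: above_def)
    then have "height b = j + Suc m" using height_iterate[OF b, of j] c by simp
    then show False using j differ height_b by (simp add: c_def)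
  qed
  have step: "\<bar>\<psi> x - \<psi> (f x)\<bar> \<le> 1" if x: "x \<in> pverts G" for x
  proof (cases "x = r \<or> x = c")
    case True
    have "\<not> above (f c)"
    proof
      assume "above (f c)"
      then obtain j where "(f ^^ j) (f c) = c" by (auto simp: above_def)
      then have "(f ^^ Suc j) c = c" unfolding funpow_Suc_right by simp
      then show False using height_iterate[OF c(1), of "Suc j"] c(2) by simp
    qed
    moreover have "above c" unfolding above_def by (rule exI[of _ 0]) simp
    ultimately show ?thesis using True c(3) by (auto simp: \<psi>_def root_fixed m_def)
  next
    case False
    have "above x \<longleftrightarrow> above (f x)"
    proof
      assume "above x"
      then obtain j where j: "(f ^^ j) x = c" by (auto simp: above_def)
      with False obtain j' where "j = Suc j'" by (cases j) auto
      with j have "(f ^^ j') (f x) = c" unfolding \<open>j = Suc j'\<close> funpow_Suc_right by simp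
      then show "above (f x)" by (auto simp: above_def)
    next
      assume "above (f x)"
      then obtain j where "(f ^^ j) (f x) = c" by (auto simp: above_def)
      then have "(f ^^ Suc j) x = c" unfolding funpow_Suc_right by simp
      then show "above x" unfolding above_def by blast
    qed
    then show ?thesis using height_Suc[OF x] False by (simp add: \<psi>_def)
  qed
  have "real_of_int (\<psi> a - \<psi> b) \<le> gdist a b"
  proof (rule potential_le_graph_dist)
    fix e assume "e \<in> parcs G"
    then obtain x y where "e = (x, y)" "x \<in> pverts G" "y \<in> pverts G" "f x = y \<or> f y = x"
      by (auto simp: parcs_eq)
    with step[of x] step[of y] show "\<psi> (fst e) - \<psi> (snd e) \<le> 1" by auto
  qed
  moreover have "\<psi> a - \<psi> b = int (Suc s + Suc t)"
    using \<open>above a\<close> \<open>\<not> above b\<close> height_a height_b by (simp add: \<psi>_def)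
  ultimately show "real (Suc s + Suc t) \<le> gdist a b" by (simp only: of_int_of_nat_eq)
qed

text \<open>
  Every vertex other than the root lies above the only child \<open>c\<close>, at distance at most \<open>w - 1\<close>
  from it.  The root is within \<open>w\<close> of every vertex, and \<open>w \<le> 2 (w - 1)\<close> because \<open>w \<ge> 2\<close>.
\<close>

lemma dist_le_if_only_child:
  assumes only_child: "\<And>x. x \<in> pverts G \<Longrightarrow> f x = r \<Longrightarrow> x \<noteq> r \<Longrightarrow> x = c"
    and height_bound: "\<And>x. x \<in> pverts G \<Longrightarrow> (f ^^ w) x = r"
    and "w \<ge> 2" and u: "u \<in> pverts G" and v: "v \<in> pverts G"
  shows "gdist u v \<le> real (2 * (w - 1))"
proof -
  have to_child: "\<exists>j < w. (f ^^ j) x = c" if x: "x \<in> pverts G" "x \<noteq> r" for x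
  proof -
    define h where "h = height (f x)"
    have h: "height x = Suc h" using height_Suc x h_def by simp
    have "(f ^^ h) x \<noteq> r" using height_le[of h x] h by auto
    moreover have "f ((f ^^ h) x) = r" using iterate_height[OF x(1)] h by simp
    ultimately have "(f ^^ h) x = c" using only_child iterate_in x(1) by blast
    moreover have "h < w" using height_le[OF height_bound[OF x(1)]] h by simp
    ultimately show ?thesis by blast
  qed
  show ?thesis
  proof (cases "u = r \<or> v = r")
    case True
    have "(f ^^ j) r = r" for j by (induction j) (simp_all add: root_fixed)
    with True consider "(f ^^ 0) u = (f ^^ w) v" | "(f ^^ w) u = (f ^^ 0) v"
      using height_bound u v by fastforce
    then show ?thesis
    proof cases
      case 1
      then show ?thesis by (rule dist_le_common_ancestor[OF u v]) (use \<open>w \<ge> 2\<close> in simp)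
    next
      case 2
      then show ?thesis by (rule dist_le_common_ancestor[OF u v]) (use \<open>w \<ge> 2\<close> in simp)
    qed
  next
    case False
    then obtain s t where "s < w" "(f ^^ s) u = c" "t < w" "(f ^^ t) v = c"
      using to_child u v by metis
    then show ?thesis by (intro dist_le_common_ancestor[OF u v, of s t]) simp_all
  qed
qed

end

section \<open>Multiplication by \<open>k\<close> modulo \<open>n\<close>\<close>

definition times_mod :: "nat \<Rightarrow> nat \<Rightarrow> int \<Rightarrow> int" where
  "times_mod k n x = int k * x mod int n"

abbreviation times_mod_graph :: "nat \<Rightarrow> nat \<Rightarrow> int pair_pre_digraph" where
  "times_mod_graph k n \<equiv> multiple_graph k (integer_mod_group n)"

lemma pverts_times_mod_graph: "n > 0 \<Longrightarrow> pverts (times_mod_graph k n) = {0..<int n}"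
  by (simp add: multiple_graph_def carrier_integer_mod_group)

lemma iterate_times_mod:
  assumes "0 \<le> x" and "x < int n"
  shows "(times_mod k n ^^ j) x = int (k ^ j) * x mod int n"
proof (induction j)
  case 0
  then show ?case using assms by simp
next
  case (Suc j)
  then show ?case by (simp add: times_mod_def mod_mult_right_eq ac_simps)
qed

lemma iterate_times_mod_minus_1:
  assumes "n > 0"
  shows "(times_mod k n ^^ j) (int n - 1) = (- int (k ^ j)) mod int n"
proof -
  have "(times_mod k n ^^ j) (int n - 1) = int (k ^ j) * (int n - 1) mod int n"
    using assms by (intro iterate_times_mod) simp_all
  also have "int (k ^ j) * (int n - 1) = - int (k ^ j) + int (k ^ j) * int n"
    by (simp add: algebra_simps)
  also have "\<dots> mod int n = (- int (k ^ j)) mod int n" by (rule mod_mult_self1)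
  finally show ?thesis .
qed

lemma iterate_times_mod_eq_0:
  assumes "n dvd k ^ w" and "0 \<le> x" and "x < int n"
  shows "(times_mod k n ^^ w) x = 0"
proof -
  have "int n dvd int (k ^ w)" using assms(1) by (simp only: int_dvd_int_iff)
  then show ?thesis using iterate_times_mod[OF assms(2,3)] by simp
qed

lemma rooted_map_times_mod:
  assumes "n > 0" and "n dvd k ^ w"
  shows "rooted_map (times_mod_graph k n) (times_mod k n) 0"
proof -
  interpret pair_graph "times_mod_graph k n"
    using assms(1) by (intro pair_graph_multiple_graph) (simp add: carrier_integer_mod_group)
  show ?thesis
  proof
    show "\<exists>j. (times_mod k n ^^ j) x = 0" if "x \<in> pverts (times_mod_graph k n)" for x
      using iterate_times_mod_eq_0[OF assms(2)] that pverts_times_mod_graph[OF assms(1)]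
      by (metis atLeastLessThan_iff)
  qed (use assms(1) in \<open>auto simp: multiple_graph_def carrier_integer_mod_group times_mod_def\<close>)
qed

lemma diam_twice_exponent:
  assumes "n > 1" and w: "n dvd k ^ Suc h" and "\<not> n dvd 2 * k ^ h"
  shows "graph_diam (with_proj (times_mod_graph k n)) = real (2 * Suc h)"
proof -
  interpret rooted_map "times_mod_graph k n" "times_mod k n" 0
    using assms(1) by (intro rooted_map_times_mod[OF _ w]) simp
  have V: "pverts (times_mod_graph k n) = {0..<int n}"
    using assms(1) by (simp add: pverts_times_mod_graph)
  let ?a = "1 :: int" and ?b = "int n - 1"
  have b_iter: "(times_mod k n ^^ j) ?b = (- int (k ^ j)) mod int n" for j
    using assms(1) by (intro iterate_times_mod_minus_1) simp
  have a_iter: "(times_mod k n ^^ j) ?a = int (k ^ j) mod int n" for j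
    using iterate_times_mod[of 1 n j k] assms(1) by simp
  have not_dvd2: "\<not> int n dvd 2 * int (k ^ h)"
    using assms(3) by (metis int_dvd_int_iff of_nat_mult of_nat_numeral)
  then have not_dvd: "\<not> int n dvd int (k ^ h)"
    by (metis dvd_mult)
  have in_V: "?a \<in> pverts (times_mod_graph k n)" "?b \<in> pverts (times_mod_graph k n)"
    unfolding V using assms(1) by simp_all
  have attained: "gdist ?a ?b = real (2 * Suc h)"
    unfolding mult_2
  proof (rule dist_eq_if_branches_meet)
    show "(times_mod k n ^^ Suc h) ?a = (times_mod k n ^^ Suc h) ?b"
      using iterate_times_mod_eq_0[OF w] assms(1) by simp
    show "(times_mod k n ^^ h) ?a \<noteq> (times_mod k n ^^ h) ?b"
      using not_dvd2 unfolding a_iter b_iter mod_eq_dvd_iff by simp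
    show "(times_mod k n ^^ h) ?a \<noteq> 0"
      using not_dvd unfolding a_iter by (simp only: mod_eq_0_iff_dvd) simp
    show "(times_mod k n ^^ h) ?b \<noteq> 0"
      using not_dvd unfolding b_iter by (simp only: mod_eq_0_iff_dvd) simp
  qed (fact in_V)+
  have upper: "gdist u v \<le> real (2 * Suc h)"
    if "u \<in> pverts (times_mod_graph k n)" "v \<in> pverts (times_mod_graph k n)" for u v
  proof -
    have iterate_0: "(times_mod k n ^^ Suc h) x = 0" if "x \<in> {0..<int n}" for x
      using iterate_times_mod_eq_0[OF w] that by (simp only: atLeastLessThan_iff)
    have "(times_mod k n ^^ Suc h) u = (times_mod k n ^^ Suc h) v"
      using iterate_0[OF that(1)[unfolded V]] iterate_0[OF that(2)[unfolded V]] by (simp only:)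
    from dist_le_common_ancestor[OF that this] show ?thesis by (simp only: mult_2 order_refl)
  qed
  show ?thesis using upper attained in_V by (rule diam_eqI)
qed

lemma diam_doubling_mod_power_2:
  fixes h :: nat
  defines "n \<equiv> 2 ^ (h + 2) :: nat"
  shows "graph_diam (with_proj (times_mod_graph 2 n)) = real (2 * (h + 1))"
proof -
  interpret rooted_map "times_mod_graph 2 n" "times_mod 2 n" 0
    by (rule rooted_map_times_mod[of _ _ "h + 2"]) (simp_all add: n_def)
  have V: "pverts (times_mod_graph 2 n) = {0..<int n}"
    by (simp add: pverts_times_mod_graph n_def)
  have n: "int n = 4 * 2 ^ h" by (simp add: n_def)
  let ?a = "1 :: int" and ?b = "int n - 1"
  have pos: "(1::int) \<le> 2 ^ h" by simp
  have b_iter: "(times_mod 2 n ^^ j) ?b = (- (2 ^ j)) mod int n" for j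
    using iterate_times_mod_minus_1[of n j 2] by (simp add: n_def)
  have a_iter: "(times_mod 2 n ^^ j) ?a = 2 ^ j mod int n" for j
    using iterate_times_mod[of 1 n j 2] n pos by simp
  have a_h: "(times_mod 2 n ^^ h) ?a = 2 ^ h"
    unfolding a_iter n by (rule mod_pos_pos_trivial) (use pos in linarith)+
  have b_h: "(times_mod 2 n ^^ h) ?b = 3 * 2 ^ h"
  proof -
    have "(- (2 ^ h)) mod int n = (- (2 ^ h) + int n) mod int n" by simp
    also have "\<dots> = 3 * 2 ^ h mod (4 * 2 ^ h)" by (simp add: n)
    also have "\<dots> = 3 * 2 ^ h" by (rule mod_pos_pos_trivial) (use pos in linarith)+
    finally show ?thesis by (simp add: b_iter)
  qed
  have in_V: "?a \<in> pverts (times_mod_graph 2 n)" "?b \<in> pverts (times_mod_graph 2 n)"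
    unfolding V n by (simp_all, use pos in linarith)
  have attained: "gdist ?a ?b = real (2 * (h + 1))"
    unfolding mult_2 Suc_eq_plus1[symmetric]
  proof (rule dist_eq_if_branches_meet)
    \<comment> \<open>The doubles \<open>2 * 2\<^sup>h\<close> and \<open>6 * 2\<^sup>h\<close> differ by \<open>n = 4 * 2\<^sup>h\<close>.\<close>
    have "(2 * 2 ^ h) mod int n = (2 * 2 ^ h + int n) mod int n" by simp
    also have "2 * 2 ^ h + int n = 2 * (3 * 2 ^ h)" by (simp add: n)
    finally show "(times_mod 2 n ^^ Suc h) ?a = (times_mod 2 n ^^ Suc h) ?b"
      by (simp add: a_h b_h times_mod_def)
    show "(times_mod 2 n ^^ h) ?a \<noteq> (times_mod 2 n ^^ h) ?b"
      "(times_mod 2 n ^^ h) ?a \<noteq> 0" "(times_mod 2 n ^^ h) ?b \<noteq> 0"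
      unfolding a_h b_h by simp_all
  qed (fact in_V)+
  have upper: "gdist u v \<le> real (2 * (h + 1))"
    if "u \<in> pverts (times_mod_graph 2 n)" "v \<in> pverts (times_mod_graph 2 n)" for u v
  proof -
    have "gdist u v \<le> real (2 * ((h + 2) - 1))"
    proof (rule dist_le_if_only_child[where c = "2 * 2 ^ h"])
      fix x assume x: "x \<in> pverts (times_mod_graph 2 n)"
      then show "(times_mod 2 n ^^ (h + 2)) x = 0"
        unfolding V atLeastLessThan_iff by (intro iterate_times_mod_eq_0) (simp_all only: n_def dvd_refl)
      assume "times_mod 2 n x = 0" "x \<noteq> 0"
      then have "2 * (2 * 2 ^ h) dvd 2 * x" by (simp add: times_mod_def mod_eq_0_iff_dvd n)
      then have "2 * 2 ^ h dvd x" by (subst (asm) dvd_mult_cancel_left) simp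
      then obtain y where y: "x = 2 * 2 ^ h * y" by (rule dvdE)
      have "0 < x" "x < 2 * 2 ^ h * 2" using x V n \<open>x \<noteq> 0\<close> by auto
      then have "0 < y" "y < 2"
        unfolding y using pos by (simp_all add: zero_less_mult_iff)
      then show "x = 2 * 2 ^ h" using y by simp
    qed (use that in simp_all)
    then show ?thesis by simp
  qed
  show ?thesis using upper attained in_V by (rule diam_eqI)
qed

text \<open>
  Modulo \<open>2 k\<^bsup>h+1\<^esup>\<close>, the \<open>(h + 1)\<close>-th iterate only sees parity: it sends odd numbers to \<open>k\<^bsup>h+1\<^esup>\<close> and
  even ones to \<open>0\<close>.  So two odd vertices are within \<open>2 (h + 1)\<close>, and when one vertex is even, one
  of the two descents to the root is a step shorter than \<open>h + 2\<close>.
\<close>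

lemma diam_double_power:
  fixes h :: nat
  assumes "even k" and "k > 2"
  defines "n \<equiv> 2 * k ^ Suc h"
  shows "graph_diam (with_proj (times_mod_graph k n)) = real (2 * h + 3)"
proof -
  have dvd: "n dvd k ^ (h + 2)"
    using assms(1) by (auto simp: n_def intro: mult_dvd_mono)
  interpret rooted_map "times_mod_graph k n" "times_mod k n" 0
    using assms(2) by (intro rooted_map_times_mod[OF _ dvd]) (simp add: n_def)
  have V: "pverts (times_mod_graph k n) = {0..<int n}"
    using assms(2) by (simp add: pverts_times_mod_graph n_def)
  define P where "P = int (k ^ h)"
  have P: "P \<ge> 1" using assms(2) by (simp add: P_def Suc_leI)
  define Q where "Q = int (k ^ Suc h)"
  have n: "int n = 2 * Q" by (simp add: n_def Q_def)
  have P_Q: "2 * P < Q" using assms(2) by (simp add: P_def Q_def not_le)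
  have in_V: "1 \<in> pverts (times_mod_graph k n)" "2 \<in> pverts (times_mod_graph k n)"
    using V n P_Q P by auto
  have even_iterate: "(times_mod k n ^^ Suc h) x = 0"
    if x: "x \<in> pverts (times_mod_graph k n)" "even x" for x
  proof -
    obtain y where "x = 2 * y" using x(2) by (rule evenE)
    then have "int (k ^ Suc h) * x = y * int n" by (simp add: n Q_def)
    then show ?thesis using iterate_times_mod[of x n "Suc h" k] x(1) V by simp
  qed
  have odd_iterate: "(times_mod k n ^^ Suc h) x = Q"
    if x: "x \<in> pverts (times_mod_graph k n)" "odd x" for x
  proof -
    obtain y where "x = 2 * y + 1" using x(2) by (rule oddE)
    then have "int (k ^ Suc h) * x = Q + y * int n"
      by (simp add: n Q_def algebra_simps)
    moreover have "Q mod int n = Q"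
      using n P_Q P by (intro mod_pos_pos_trivial) simp_all
    ultimately show ?thesis using iterate_times_mod[of x n "Suc h" k] x(1) V by simp
  qed
  have sum: "2 * h + 3 = Suc (Suc h) + Suc h" by simp
  have attained: "gdist 1 2 = real (2 * h + 3)"
    unfolding sum
  proof (rule dist_eq_if_branches_meet)
    have one: "(times_mod k n ^^ Suc h) 1 = Q"
      using odd_iterate in_V(1) by simp
    have "P * 2 mod int n = 2 * P"
      using n P_Q P by (subst mod_pos_pos_trivial) simp_all
    then have two: "(times_mod k n ^^ h) 2 = 2 * P"
      using iterate_times_mod[of 2 n h k] in_V(2) V by (simp add: P_def)
    show "(times_mod k n ^^ Suc h) 1 \<noteq> (times_mod k n ^^ h) 2"
      unfolding one two using P_Q by simp
    show "(times_mod k n ^^ Suc h) 1 \<noteq> 0" unfolding one using P_Q P by linarith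
    show "(times_mod k n ^^ h) 2 \<noteq> 0" unfolding two using P by simp
    have "(times_mod k n ^^ (h + 2)) 1 = 0"
      using iterate_times_mod_eq_0[OF dvd] in_V(1) V by simp
    then show "(times_mod k n ^^ Suc (Suc h)) 1 = (times_mod k n ^^ Suc h) 2"
      using even_iterate[OF in_V(2)] by (simp only: add_2_eq_Suc') simp
  qed (fact in_V)+
  have upper: "gdist u v \<le> real (2 * h + 3)"
    if u: "u \<in> pverts (times_mod_graph k n)" and v: "v \<in> pverts (times_mod_graph k n)" for u v
  proof -
    have root: "(times_mod k n ^^ Suc (Suc h)) x = 0" if "x \<in> pverts (times_mod_graph k n)" for x
      using iterate_times_mod_eq_0[OF dvd, of x] that V by (simp only: add_2_eq_Suc') simp
    show ?thesis
    proof (cases "even u")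
      case True
      then have "(times_mod k n ^^ Suc h) u = (times_mod k n ^^ Suc (Suc h)) v"
        using even_iterate[OF u] root[OF v] by (simp only:)
      then show ?thesis by (rule dist_le_common_ancestor[OF u v]) simp
    next
      case u_odd: False
      show ?thesis
      proof (cases "even v")
        case True
        then have "(times_mod k n ^^ Suc (Suc h)) u = (times_mod k n ^^ Suc h) v"
          using even_iterate[OF v] root[OF u] by (simp only:)
        then show ?thesis by (rule dist_le_common_ancestor[OF u v]) simp
      next
        case False
        have "(times_mod k n ^^ Suc h) u = (times_mod k n ^^ Suc h) v"
          using odd_iterate[OF v False] odd_iterate[OF u u_odd] by (simp only:)
        then show ?thesis by (rule dist_le_common_ancestor[OF u v]) simp
      qed
    qed
  qed
  show ?thesis using upper attained in_V by (rule diam_eqI)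
qed

section \<open>The exponents and the diameter\<close>

lemma Least_exponent_power:
  fixes k i :: nat
  assumes "k > 1" and "i > 0"
  shows "(LEAST j. j > 0 \<and> k ^ i dvd k ^ j) = i"
  using assms by (intro Least_equality) (auto dest: power_dvd_imp_le)

lemma Least_exponent_multiple_of_power:
  fixes k i q :: nat
  assumes "k > 1" and "q \<noteq> 1" and "q dvd k"
  shows "(LEAST j. j > 0 \<and> q * k ^ i dvd k ^ j) = i + 1"
proof (rule Least_equality)
  show "i + 1 > 0 \<and> q * k ^ i dvd k ^ (i + 1)"
    using assms(3) by (simp add: mult_dvd_mono)
next
  fix j assume j: "j > 0 \<and> q * k ^ i dvd k ^ j"
  then have "k ^ i dvd k ^ j" using dvd_mult_right by blast
  then have "i \<le> j" using assms(1) by (rule power_dvd_imp_le)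
  moreover have "i \<noteq> j"
  proof
    assume "i = j"
    with j assms(1,2) show False by simp
  qed
  ultimately show "i + 1 \<le> j" by simp
qed

theorem theorem3p11:
  fixes n k q i w :: nat and D :: ereal
  assumes "n > 2" and "k > 1" and "k dvd n"
    and "\<forall>p. prime p \<and> p dvd n \<longrightarrow> p dvd k"
    and "i = (GREATEST j. j > 0 \<and> k ^ j dvd n)"
    and "n = q * k ^ i" and "1 \<le> q" and "q < k"
    and "w = (LEAST j. j > 0 \<and> n dvd k ^ j)"
    and "D = graph_diam (with_proj (multiple_graph k (integer_mod_group n)))"
  shows "((q = 1 \<longrightarrow> w = i) \<and> (q \<noteq> 1 \<and> q dvd k \<longrightarrow> w = i + 1))
    \<and> (q = 1 \<and> k > 2 \<longrightarrow> D = real (2 * i) \<and> D = real (2 * w))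
    \<and> (q = 1 \<and> k = 2 \<longrightarrow> D = real (2 * (i - 1)) \<and> D = real (2 * (w - 1)))
    \<and> (q = 2 \<longrightarrow> D = real (2 * w - 1) \<and> D = real (2 * i + 1))
    \<and> (q > 2 \<and> q dvd k \<longrightarrow> D = real (2 * w) \<and> D = real (2 * (i + 1)))"
proof -
  note n = \<open>n = q * k ^ i\<close>
  have "i \<noteq> 0"
  proof
    assume "i = 0"
    with n \<open>q < k\<close> have "n < k" by simp
    with \<open>k dvd n\<close> \<open>n > 2\<close> show False by (auto dest: dvd_imp_le)
  qed
  then obtain h where i: "i = Suc h" by (cases i) auto
  have w_1: "w = i" if "q = 1"
    using Least_exponent_power[OF \<open>k > 1\<close>, of i] \<open>i \<noteq> 0\<close> that n \<open>w = _\<close> by simp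
  have w_q: "w = i + 1" if "q \<noteq> 1" "q dvd k"
    using Least_exponent_multiple_of_power[OF \<open>k > 1\<close> that, of i] n \<open>w = _\<close> by simp
  have D_1: "D = real (2 * i)" if "q = 1" "k > 2"
  proof -
    have "\<not> k * k ^ h dvd 2 * k ^ h"
      using that(2) by (auto dest: dvd_imp_le)
    then have "\<not> n dvd 2 * k ^ h" using n that i by simp
    then show ?thesis
      unfolding \<open>D = _\<close> i using \<open>n > 2\<close> n that(1) i by (intro diam_twice_exponent) auto
  qed
  have D_k_2: "D = real (2 * (i - 1))" if "q = 1" "k = 2"
  proof -
    have "h \<noteq> 0" using \<open>n > 2\<close> n that i by (intro notI) simp
    then obtain h' where "h = Suc h'" by (cases h) auto
    then show ?thesis
      unfolding \<open>D = _\<close> using diam_doubling_mod_power_2[of h'] n that i by simp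
  qed
  have q_2: "2 dvd k" if "q = 2"
    using that n two_is_prime_nat \<open>\<forall>p. _ p\<close> by auto
  have D_2: "D = real (2 * i + 1)" if "q = 2"
    unfolding \<open>D = _\<close> n that i
    using diam_double_power[OF q_2[OF that], of h] \<open>q < k\<close> that by (simp add: numeral_3_eq_3)
  have D_q: "D = real (2 * (i + 1))" if "q > 2" "q dvd k"
  proof -
    have "\<not> q * k ^ i dvd 2 * k ^ i"
      using that(1) \<open>k > 1\<close> by (auto dest: dvd_imp_le)
    moreover have "n dvd k ^ Suc i" using n that(2) by (simp add: mult_dvd_mono)
    ultimately show ?thesis
      unfolding \<open>D = _\<close> using \<open>n > 2\<close> n diam_twice_exponent[of n k i] by simp
  qed
  have "w = i + 1" if "q = 2" using w_q q_2 that by simp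
  then have "2 * w - 1 = 2 * i + 1" if "q = 2" using that by simp
  then show ?thesis
    using w_1 w_q D_1 D_k_2 D_2 D_q by auto
qed

end
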